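(* Let $\mathcal{C}$ be a congruence-modular equational class, let $A,B$ be members of $\mathcal{C}$ and let $f:A\to B$ be an admissible morphism in $\mathcal{C}$. Then: (1) if $\mathrm{Spec}(A)=\mathrm{Max}(A)$, then $f$ fulfills GU; (2) if the commutator in $A$ equals the intersection of congruences and $\mathrm{Con}(A)$ is a Boolean algebra, then $f$ fulfills GU; (3) if $\mathcal{C}$ is congruence-distributive and $\mathrm{Con}(A)$ is a Boolean algebra, then $f$ fulfills GU.
   Context: An equational class (variety) $\mathcal{C}$ of algebras of a fixed type is congruence-modular (respectively congruence-distributive) if the congruence lattice $\mathrm{Con}(M)$ is modular (respectively distributive) for every member $M$ of $\mathcal{C}$. All algebras are non-empty; a morphism in $\mathcal{C}$ is a homomorphism between members of $\mathcal{C}$. For an algebra $M$, $\Delta_M$ is the equality relation and $\nabla_M=M^2$; $\mathrm{Max}(M)$ is the set of maximal elements of $\mathrm{Con}(M)\setminus\{\nabla_M\}$ with respect to inclusion. In a congruence-modular class, the commutator $[\alpha,\beta]_M$ of $\alpha,\beta\in\mathrm{Con}(M)$ is the (Freese--McKenzie) modular commutator, i.e. the smallest congruence $\delta$ of $M$ such that, for every term $t(\bar x,\bar y)$ and all tuples $\bar a,\bar b,\bar c,\bar d$ of elements of $M$ with $(a_i,b_i)\in\alpha$ for all $i$ and $(c_j,d_j)\in\beta$ for all $j$, $(t(\bar a,\bar c),t(\bar a,\bar d))\in\delta$ implies $(t(\bar b,\bar c),t(\bar b,\bar d))\in\delta$; in congruence-distributive classes it equals $\alpha\cap\beta$. A congruence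 $\phi\neq\nabla_M$ is prime if, for all $\alpha,\beta\in\mathrm{Con}(M)$, $[\alpha,\beta]_M\subseteq\phi$ implies $\alpha\subseteq\phi$ or $\beta\subseteq\phi$; $\mathrm{Spec}(M)$ is the set of prime congruences of $M$. For a morphism $f:A\to B$ and $\psi\in\mathrm{Con}(B)$, $f^*(\psi)=\{(x,y)\in A^2 : (f(x),f(y))\in\psi\}\in\mathrm{Con}(A)$. $f$ is admissible if $f^*(\psi)\in\mathrm{Spec}(A)$ for all $\psi\in\mathrm{Spec}(B)$. An admissible morphism $f:A\to B$ fulfills GU (Going Up) if for all $\phi,\psi\in\mathrm{Spec}(A)$ and $\phi_1\in\mathrm{Spec}(B)$ with $\phi\subseteq\psi$ and $f^*(\phi_1)=\phi$ there is $\psi_1\in\mathrm{Spec}(B)$ with $\phi_1\subseteq\psi_1$ and $f^*(\psi_1)=\psi$. *)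

theory Defs
  imports "HOL-Algebra.Complete_Lattice"
begin

section \<open>Modular, distributive and Boolean lattices\<close>

locale modular_lattice = lattice +
  assumes modular:
    "\<lbrakk>x \<in> carrier L; y \<in> carrier L; z \<in> carrier L; x \<sqsubseteq> z\<rbrakk>
      \<Longrightarrow> x \<squnion> (y \<sqinter> z) = (x \<squnion> y) \<sqinter> z"

locale distributive_lattice = lattice +
  assumes distributive:
    "\<lbrakk>x \<in> carrier L; y \<in> carrier L; z \<in> carrier L\<rbrakk>
      \<Longrightarrow> x \<sqinter> (y \<squnion> z) = (x \<sqinter> y) \<squnion> (x \<sqinter> z)"

locale boolean_lattice = distributive_lattice + bounded_lattice +
  assumes complemented:
    "x \<in> carrier L \<Longrightarrow> \<exists>y\<in>carrier L. x \<sqinter> y = \<bottom> \<and> x \<squnion> y = \<top>"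


section \<open>Algebras of a fixed type, terms and equational classes\<close>

text \<open>
  The symbols in the domain of a signature are the operation symbols, mapped to their arities.
  Using a partial map (rather than all of the type of symbols) also covers the empty signature.
\<close>

type_synonym 'f signature = "'f \<Rightarrow> nat option"

record ('f, 'a) ualg = "'a partial_object" +
  interp :: "'f \<Rightarrow> 'a list \<Rightarrow> 'a"

definition ualgebra :: "'f signature \<Rightarrow> ('f, 'a) ualg \<Rightarrow> bool" where
  "ualgebra S M \<longleftrightarrow> carrier M \<noteq> {} \<and>
     (\<forall>f xs. S f = Some (length xs) \<longrightarrow> set xs \<subseteq> carrier M \<longrightarrow> interp M f xs \<in> carrier M)"

definition hom :: "'f signature \<Rightarrow> ('f, 'a) ualg \<Rightarrow> ('f, 'b) ualg \<Rightarrow> ('a \<Rightarrow> 'b) set" where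
  "hom S M N = {h. h \<in> carrier M \<rightarrow> carrier N \<and>
     (\<forall>f xs. S f = Some (length xs) \<longrightarrow> set xs \<subseteq> carrier M \<longrightarrow>
        h (interp M f xs) = interp N f (map h xs))}"

datatype ('f, 'v) trm = Var 'v | Op 'f "('f, 'v) trm list"

inductive_set terms :: "'f signature \<Rightarrow> ('f, 'v) trm set" for S where
  Var: "Var x \<in> terms S"
| Op: "S f = Some (length ts) \<Longrightarrow> \<forall>t\<in>set ts. t \<in> terms S \<Longrightarrow> Op f ts \<in> terms S"

primrec eval :: "('f, 'a) ualg \<Rightarrow> ('v \<Rightarrow> 'a) \<Rightarrow> ('f, 'v) trm \<Rightarrow> 'a" where
  "eval M v (Var x) = v x"
| "eval M v (Op f ts) = interp M f (map (eval M v) ts)"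

type_synonym 'f equations = "(('f, nat) trm \<times> ('f, nat) trm) set"

text \<open>The members, with elements in the type \<open>'a\<close>, of the equational class axiomatized by \<open>E\<close>.\<close>

definition models :: "'f signature \<Rightarrow> 'f equations \<Rightarrow> ('f, 'a) ualg set" where
  "models S E = {M. ualgebra S M \<and>
     (\<forall>(s, t)\<in>E. \<forall>v. range v \<subseteq> carrier M \<longrightarrow> eval M v s = eval M v t)}"


section \<open>Congruences\<close>

definition Con :: "'f signature \<Rightarrow> ('f, 'a) ualg \<Rightarrow> ('a \<times> 'a) set set" where
  "Con S M = {\<theta>. equiv (carrier M) \<theta> \<and>
     (\<forall>f xs ys. S f = Some (length xs) \<longrightarrow> list_all2 (\<lambda>x y. (x, y) \<in> \<theta>) xs ys \<longrightarrow>
        (interp M f xs, interp M f ys) \<in> \<theta>)}"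

definition con_lattice :: "'f signature \<Rightarrow> ('f, 'a) ualg \<Rightarrow> ('a \<times> 'a) set gorder" where
  "con_lattice S M = \<lparr>carrier = Con S M, eq = (=), le = (\<subseteq>)\<rparr>"

abbreviation nabla :: "('f, 'a) ualg \<Rightarrow> ('a \<times> 'a) set" where
  "nabla M \<equiv> carrier M \<times> carrier M"

definition Max_con :: "'f signature \<Rightarrow> ('f, 'a) ualg \<Rightarrow> ('a \<times> 'a) set set" where
  "Max_con S M = {\<phi> \<in> Con S M - {nabla M}. \<forall>\<theta> \<in> Con S M - {nabla M}. \<phi> \<subseteq> \<theta> \<longrightarrow> \<theta> = \<phi>}"

text \<open>
  HOL cannot quantify over all types inside a definition, so the members of the equational class
  are taken here with elements in the type of terms over countably many variables. This is no
  restriction: a failure of the modular (or distributive) law in a congruence lattice involves only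
  finitely many elements, hence already occurs in a finitely generated subalgebra, and such
  a subalgebra is isomorphic to an algebra whose elements are terms. The lemmas
  \<open>congruence_modularD\<close> and \<open>congruence_distributiveD\<close> below prove that the two properties
  give modularity (distributivity) for the members of the class over every type.
\<close>

definition congruence_modular :: "'f signature \<Rightarrow> 'f equations \<Rightarrow> bool" where
  "congruence_modular S E \<longleftrightarrow>
     (\<forall>M :: ('f, ('f, nat) trm) ualg. M \<in> models S E \<longrightarrow> modular_lattice (con_lattice S M))"

definition congruence_distributive :: "'f signature \<Rightarrow> 'f equations \<Rightarrow> bool" where
  "congruence_distributive S E \<longleftrightarrow>
     (\<forall>M :: ('f, ('f, nat) trm) ualg. M \<in> models S E \<longrightarrow> distributive_lattice (con_lattice S M))"


section \<open>Commutator, prime congruences, admissible morphisms, Going Up\<close>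

text \<open>
  In a term \<open>t(x, y)\<close>, the variables \<open>Inl i\<close> form the tuple \<open>x\<close> and the variables \<open>Inr j\<close> the
  tuple \<open>y\<close>. The tuples of elements are indexed by all of \<open>nat\<close>, but only the finitely many
  entries whose variable occurs in \<open>t\<close> matter.
\<close>

definition term_condition ::
    "'f signature \<Rightarrow> ('f, 'a) ualg \<Rightarrow> ('a \<times> 'a) set \<Rightarrow> ('a \<times> 'a) set \<Rightarrow> ('a \<times> 'a) set \<Rightarrow> bool" where
  "term_condition S M \<alpha> \<beta> \<delta> \<longleftrightarrow>
     (\<forall>t \<in> (terms S :: ('f, nat + nat) trm set). \<forall>a b c d.
        (\<forall>i. (a i, b i) \<in> \<alpha>) \<longrightarrow> (\<forall>j. (c j, d j) \<in> \<beta>) \<longrightarrow>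
        (eval M (case_sum a c) t, eval M (case_sum a d) t) \<in> \<delta> \<longrightarrow>
        (eval M (case_sum b c) t, eval M (case_sum b d) t) \<in> \<delta>)"

definition commutator ::
    "'f signature \<Rightarrow> ('f, 'a) ualg \<Rightarrow> ('a \<times> 'a) set \<Rightarrow> ('a \<times> 'a) set \<Rightarrow> ('a \<times> 'a) set" where
  "commutator S M \<alpha> \<beta> = \<Inter> {\<delta> \<in> Con S M. term_condition S M \<alpha> \<beta> \<delta>}"

definition Spec :: "'f signature \<Rightarrow> ('f, 'a) ualg \<Rightarrow> ('a \<times> 'a) set set" where
  "Spec S M = {\<phi> \<in> Con S M. \<phi> \<noteq> nabla M \<and>
     (\<forall>\<alpha>\<in>Con S M. \<forall>\<beta>\<in>Con S M. commutator S M \<alpha> \<beta> \<subseteq> \<phi> \<longrightarrow> \<alpha> \<subseteq> \<phi> \<or> \<beta> \<subseteq> \<phi>)}"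

definition pullback :: "('f, 'a) ualg \<Rightarrow> ('a \<Rightarrow> 'b) \<Rightarrow> ('b \<times> 'b) set \<Rightarrow> ('a \<times> 'a) set" where
  "pullback A f \<psi> = {(x, y) \<in> carrier A \<times> carrier A. (f x, f y) \<in> \<psi>}"

definition admissible ::
    "'f signature \<Rightarrow> ('f, 'a) ualg \<Rightarrow> ('f, 'b) ualg \<Rightarrow> ('a \<Rightarrow> 'b) \<Rightarrow> bool" where
  "admissible S A B f \<longleftrightarrow> f \<in> hom S A B \<and> (\<forall>\<psi>\<in>Spec S B. pullback A f \<psi> \<in> Spec S A)"

definition fulfills_GU ::
    "'f signature \<Rightarrow> ('f, 'a) ualg \<Rightarrow> ('f, 'b) ualg \<Rightarrow> ('a \<Rightarrow> 'b) \<Rightarrow> bool" where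
  "fulfills_GU S A B f \<longleftrightarrow>
     (\<forall>\<phi>\<in>Spec S A. \<forall>\<psi>\<in>Spec S A. \<forall>\<phi>\<^sub>1\<in>Spec S B. \<phi> \<subseteq> \<psi> \<longrightarrow> pullback A f \<phi>\<^sub>1 = \<phi> \<longrightarrow>
        (\<exists>\<psi>\<^sub>1\<in>Spec S B. \<phi>\<^sub>1 \<subseteq> \<psi>\<^sub>1 \<and> pullback A f \<psi>\<^sub>1 = \<psi>))"


section \<open>The commutator is the smallest congruence satisfying the term condition\<close>

lemma ConI:
  assumes "equiv (carrier M) \<theta>"
    and "\<And>f xs ys. \<lbrakk>S f = Some (length xs); list_all2 (\<lambda>x y. (x, y) \<in> \<theta>) xs ys\<rbrakk>
      \<Longrightarrow> (interp M f xs, interp M f ys) \<in> \<theta>"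
  shows "\<theta> \<in> Con S M"
  using assms by (auto simp: Con_def)

lemma Con_equiv: "\<theta> \<in> Con S M \<Longrightarrow> equiv (carrier M) \<theta>"
  by (auto simp: Con_def)

lemma Con_compat:
  "\<lbrakk>\<theta> \<in> Con S M; S f = Some (length xs); list_all2 (\<lambda>x y. (x, y) \<in> \<theta>) xs ys\<rbrakk>
    \<Longrightarrow> (interp M f xs, interp M f ys) \<in> \<theta>"
  by (auto simp: Con_def)

lemma Con_sub: "\<theta> \<in> Con S M \<Longrightarrow> \<theta> \<subseteq> nabla M"
  by (auto simp: Con_def equiv_def)

lemma nabla_in_Con:
  assumes "ualgebra S M" shows "nabla M \<in> Con S M"
proof (rule ConI)
  show "equiv (carrier M) (nabla M)"
    by (auto simp: equiv_def refl_on_def sym_def trans_def)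
  fix f xs ys
  assume S: "S f = Some (length xs)" and xy: "list_all2 (\<lambda>x y. (x, y) \<in> nabla M) xs ys"
  from xy have "length xs = length ys" "set xs \<subseteq> carrier M" "set ys \<subseteq> carrier M"
    by (auto simp: list_all2_conv_all_nth in_set_conv_nth)
  with S assms show "(interp M f xs, interp M f ys) \<in> nabla M"
    by (auto simp: ualgebra_def)
qed

lemma Inter_in_Con:
  assumes "A \<noteq> {}" "A \<subseteq> Con S M" shows "\<Inter> A \<in> Con S M"
proof (rule ConI)
  have *: "equiv (carrier M) \<theta>" if "\<theta> \<in> A" for \<theta>
    using that assms Con_equiv by blast
  show "equiv (carrier M) (\<Inter> A)"
  proof (rule equivI)
    show "\<Inter> A \<subseteq> carrier M \<times> carrier M" using * assms(1) by (fastforce simp: equiv_def)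
    show "refl_on (carrier M) (\<Inter> A)" using * by (fastforce simp: equiv_def refl_on_def)
    show "sym (\<Inter> A)" using * by (auto simp: equiv_def sym_def)
    show "trans (\<Inter> A)" using * unfolding equiv_def trans_def by blast
  qed
  fix f xs ys
  assume S: "S f = Some (length xs)" and xy: "list_all2 (\<lambda>x y. (x, y) \<in> \<Inter> A) xs ys"
  have "(interp M f xs, interp M f ys) \<in> \<theta>" if "\<theta> \<in> A" for \<theta>
  proof (rule Con_compat)
    show "\<theta> \<in> Con S M" using that assms by blast
    show "list_all2 (\<lambda>x y. (x, y) \<in> \<theta>) xs ys"
      using xy by (rule list_all2_mono) (use that in auto)
  qed (rule S)
  thus "(interp M f xs, interp M f ys) \<in> \<Inter> A" by auto
qed

lemma ualgebra_closed:
  "\<lbrakk>ualgebra S M; S f = Some (length xs); set xs \<subseteq> carrier M\<rbrakk> \<Longrightarrow> interp M f xs \<in> carrier M"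
  by (auto simp: ualgebra_def)

lemma eval_closed:
  assumes "ualgebra S M" "t \<in> terms S" "range v \<subseteq> carrier M"
  shows "eval M v t \<in> carrier M"
  using assms(2)
proof (induction rule: terms.induct)
  case (Op f ts)
  have "interp M f (map (eval M v) ts) \<in> carrier M"
    by (rule ualgebra_closed[OF assms(1)]) (use Op in auto)
  then show ?case by simp
qed (use assms in auto)

lemma commutator_least:
  assumes "ualgebra S M" "\<alpha> \<in> Con S M" "\<beta> \<in> Con S M"
  shows "least (con_lattice S M) (commutator S M \<alpha> \<beta>)
           {\<delta> \<in> Con S M. term_condition S M \<alpha> \<beta> \<delta>}"
proof -
  let ?D = "{\<delta> \<in> Con S M. term_condition S M \<alpha> \<beta> \<delta>}"
  have "nabla M \<in> ?D"
  proof -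
    have "term_condition S M \<alpha> \<beta> (nabla M)"
      unfolding term_condition_def
    proof (intro ballI allI impI)
      fix t :: "('a, nat + nat) trm" and a b c d :: "nat \<Rightarrow> 'b"
      assume t: "t \<in> terms S" and "\<forall>i. (a i, b i) \<in> \<alpha>" "\<forall>j. (c j, d j) \<in> \<beta>"
      hence "\<forall>i. b i \<in> carrier M \<and> c i \<in> carrier M \<and> d i \<in> carrier M"
        using Con_sub[OF assms(2)] Con_sub[OF assms(3)] by blast
      hence "range (case_sum b c) \<subseteq> carrier M" "range (case_sum b d) \<subseteq> carrier M"
        by (auto split: sum.splits)
      thus "(eval M (case_sum b c) t, eval M (case_sum b d) t) \<in> nabla M"
        using eval_closed[OF assms(1) t] by blast
    qed
    thus ?thesis using nabla_in_Con[OF assms(1)] by simp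
  qed
  hence "commutator S M \<alpha> \<beta> \<in> Con S M"
    unfolding commutator_def by (intro Inter_in_Con) auto
  moreover have "term_condition S M \<alpha> \<beta> (commutator S M \<alpha> \<beta>)"
    unfolding commutator_def term_condition_def by blast
  ultimately show ?thesis
    by (auto simp: least_def con_lattice_def commutator_def)
qed


section \<open>Congruence lattices\<close>

lemma complete_lattice_Con:
  assumes "ualgebra S M" shows "complete_lattice (con_lattice S M)"
proof -
  interpret partial_order "con_lattice S M"
    by unfold_locales (auto simp: con_lattice_def)
  show ?thesis
  proof (rule complete_latticeI)
    fix A assume A: "A \<subseteq> carrier (con_lattice S M)"
    let ?U = "{\<theta> \<in> Con S M. \<forall>\<alpha>\<in>A. \<alpha> \<subseteq> \<theta>}"
    have "nabla M \<in> ?U"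
      using A nabla_in_Con[OF assms] Con_sub by (fastforce simp: con_lattice_def)
    hence "\<Inter> ?U \<in> Con S M" by (intro Inter_in_Con) auto
    hence "least (con_lattice S M) (\<Inter> ?U) (Upper (con_lattice S M) A)"
      using A by (auto simp: least_def Upper_def con_lattice_def)
    thus "\<exists>s. least (con_lattice S M) s (Upper (con_lattice S M) A)" ..
  next
    fix A assume A: "A \<subseteq> carrier (con_lattice S M)"
    let ?i = "\<Inter> (insert (nabla M) A)"
    have "?i \<in> Con S M"
      using A nabla_in_Con[OF assms] by (intro Inter_in_Con) (auto simp: con_lattice_def)
    hence "greatest (con_lattice S M) ?i (Lower (con_lattice S M) A)"
      using A Con_sub unfolding greatest_def Lower_def con_lattice_def by fastforce
    thus "\<exists>i. greatest (con_lattice S M) i (Lower (con_lattice S M) A)" ..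
  qed
qed

lemma Con_simps [simp]:
  "carrier (con_lattice S M) = Con S M"
  "le (con_lattice S M) = (\<subseteq>)"
  by (simp_all add: con_lattice_def)

lemma lattice_Con: "ualgebra S M \<Longrightarrow> lattice (con_lattice S M)"
  by (rule complete_lattice_lattice[OF complete_lattice_Con])

lemma Con_Int:
  "\<lbrakk>\<alpha> \<in> Con S M; \<beta> \<in> Con S M\<rbrakk> \<Longrightarrow> \<alpha> \<inter> \<beta> \<in> Con S M"
  using Inter_in_Con[of "{\<alpha>, \<beta>}" S M] by simp

lemma meet_Con:
  assumes "ualgebra S M" "\<alpha> \<in> Con S M" "\<beta> \<in> Con S M"
  shows "\<alpha> \<sqinter>\<^bsub>con_lattice S M\<^esub> \<beta> = \<alpha> \<inter> \<beta>"
proof -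
  interpret lattice "con_lattice S M" by (rule lattice_Con[OF assms(1)])
  have "\<alpha> \<sqinter>\<^bsub>con_lattice S M\<^esub> \<beta> \<subseteq> \<alpha> \<inter> \<beta>"
    using meet_left meet_right assms(2,3) by fastforce
  moreover have "\<alpha> \<inter> \<beta> \<subseteq> \<alpha> \<sqinter>\<^bsub>con_lattice S M\<^esub> \<beta>"
    using meet_le[of "\<alpha> \<inter> \<beta>" \<alpha> \<beta>] assms(2,3) Con_Int by fastforce
  ultimately show ?thesis by blast
qed

lemma list_all2_rtrancl_compat:
  assumes "list_all2 (\<lambda>x y. (x, y) \<in> R\<^sup>*) xs ys" "set xs \<subseteq> X" "R \<subseteq> X \<times> X"
    and step: "\<And>zs x y ws. \<lbrakk>set zs \<subseteq> X; set ws \<subseteq> X; (x, y) \<in> R; length zs + length ws + 1 = n\<rbrakk>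
      \<Longrightarrow> (F (zs @ x # ws), F (zs @ y # ws)) \<in> R"
    and "set zs \<subseteq> X" "length zs + length xs = n"
  shows "(F (zs @ xs), F (zs @ ys)) \<in> R\<^sup>*"
  using assms(1,2,5,6)
proof (induction xs ys arbitrary: zs rule: list_all2_induct)
  case (Cons x xs y ys)
  have 1: "(F (zs @ x # xs), F (zs @ y # xs)) \<in> R\<^sup>* \<and> y \<in> X"
    using Cons.hyps(1)
  proof (induction rule: rtrancl_induct)
    case base
    then show ?case using Cons.prems by auto
  next
    case (step u w)
    have "(F (zs @ u # xs), F (zs @ w # xs)) \<in> R"
      by (rule assms(4)) (use step Cons.prems in auto)
    with step assms(3) show ?case by auto
  qed
  moreover have "(F ((zs @ [y]) @ xs), F ((zs @ [y]) @ ys)) \<in> R\<^sup>*"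
    by (rule Cons.IH) (use 1 Cons.prems in auto)
  ultimately show ?case by (auto intro: rtrancl_trans)
qed simp

lemma join_Con_rtrancl:
  assumes M: "ualgebra S M" and \<alpha>: "\<alpha> \<in> Con S M" and \<beta>: "\<beta> \<in> Con S M"
  shows "\<alpha> \<squnion>\<^bsub>con_lattice S M\<^esub> \<beta> \<subseteq> (\<alpha> \<union> \<beta>)\<^sup>*"
proof -
  interpret lattice "con_lattice S M" by (rule lattice_Con[OF M])
  let ?R = "\<alpha> \<union> \<beta>" and ?X = "carrier M"
  let ?T = "?R\<^sup>* \<inter> nabla M"
  have RX: "?R \<subseteq> nabla M" using Con_sub[OF \<alpha>] Con_sub[OF \<beta>] by blast
  have refl: "(x, x) \<in> \<alpha> \<and> (x, x) \<in> \<beta>" if "x \<in> ?X" for x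
    using that Con_equiv[OF \<alpha>] Con_equiv[OF \<beta>] by (auto simp: equiv_def refl_on_def)
  have symR: "sym ?R"
    using Con_equiv[OF \<alpha>] Con_equiv[OF \<beta>] by (auto simp: equiv_def intro: sym_Un)
  have T: "?T \<in> Con S M"
  proof (rule ConI)
    have "sym ?T"
      using sym_rtrancl[OF symR] by (auto simp: sym_def)
    moreover have "trans ?T"
      by (auto simp: trans_def)
    ultimately show "equiv ?X ?T"
      by (auto simp: equiv_def refl_on_def)
    fix f xs ys
    assume S: "S f = Some (length xs)" and xy: "list_all2 (\<lambda>x y. (x, y) \<in> ?T) xs ys"
    have len: "length xs = length ys" and X: "set xs \<subseteq> ?X" "set ys \<subseteq> ?X"
      using xy by (auto simp: list_all2_conv_all_nth in_set_conv_nth)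
    have xy': "list_all2 (\<lambda>x y. (x, y) \<in> ?R\<^sup>*) xs ys"
      using xy by (rule list_all2_mono) auto
    have "(interp M f ([] @ xs), interp M f ([] @ ys)) \<in> ?R\<^sup>*"
    proof (rule list_all2_rtrancl_compat[where X = ?X and n = "length xs"])
      fix zs x y ws
      assume zw: "set zs \<subseteq> ?X" "set ws \<subseteq> ?X" and R: "(x, y) \<in> ?R"
        and n: "length zs + length ws + 1 = length xs"
      have "list_all2 (\<lambda>x y. (x, y) \<in> \<theta>) (zs @ x # ws) (zs @ y # ws)"
        if "(x, y) \<in> \<theta>" "\<theta> \<in> {\<alpha>, \<beta>}" for \<theta>
      proof -
        have "list_all2 (\<lambda>x y. (x, y) \<in> \<theta>) us us" if "set us \<subseteq> ?X" for us
          using that refl \<open>\<theta> \<in> {\<alpha>, \<beta>}\<close> by (auto simp: list_all2_same)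
        thus ?thesis using that(1) zw by (simp add: list_all2_appendI)
      qed
      moreover have "S f = Some (length (zs @ x # ws))" using S n by simp
      ultimately show "(interp M f (zs @ x # ws), interp M f (zs @ y # ws)) \<in> ?R"
        using R Con_compat[OF \<alpha>, of f "zs @ x # ws" "zs @ y # ws"]
          Con_compat[OF \<beta>, of f "zs @ x # ws" "zs @ y # ws"] by auto
    qed (use xy' X RX in auto)
    moreover have "interp M f xs \<in> ?X" "interp M f ys \<in> ?X"
      using M S X len by (auto simp: ualgebra_def)
    ultimately show "(interp M f xs, interp M f ys) \<in> ?T" by simp
  qed
  have "\<alpha> \<subseteq> ?T" "\<beta> \<subseteq> ?T" using RX by auto
  with join_le[of \<alpha> ?T \<beta>] \<alpha> \<beta> T show ?thesis by auto
qed


section \<open>Congruence-modularity and -distributivity do not depend on the chosen type\<close>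

lemma eval_hom:
  assumes "ualgebra S N" "h \<in> hom S N M" "t \<in> terms S" "range v \<subseteq> carrier N"
  shows "h (eval N v t) = eval M (h \<circ> v) t"
  using assms(3)
proof (induction rule: terms.induct)
  case (Op f ts)
  have "set (map (eval N v) ts) \<subseteq> carrier N"
    using Op.IH eval_closed[OF assms(1) _ assms(4)] by auto
  hence "h (eval N v (Op f ts)) = interp M f (map h (map (eval N v) ts))"
    using assms(2) Op.hyps unfolding hom_def by fastforce
  also have "map h (map (eval N v) ts) = map (eval M (h \<circ> v)) ts"
    unfolding map_map
  proof (rule map_cong[OF HOL.refl])
    fix t assume "t \<in> set ts"
    hence "h (eval N v t) = eval M (h \<circ> v) t" using Op.IH by blast
    thus "(h \<circ> eval N v) t = eval M (h \<circ> v) t" by (simp only: o_apply)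
  qed
  finally show ?case by (simp only: eval.simps)
qed simp

lemma term_subalgebra:
  fixes M :: "('f, 'a) ualg" and v :: "nat \<Rightarrow> 'a"
  assumes M: "M \<in> models S E" and E: "E \<subseteq> terms S \<times> terms S" and v: "range v \<subseteq> carrier M"
  obtains N :: "('f, ('f, nat) trm) ualg" and h
  where "N \<in> models S E" "h \<in> hom S N M" "range v \<subseteq> h ` carrier N" "inj_on h (carrier N)"
proof -
  have uM: "ualgebra S M" using M by (simp add: models_def)
  define Y where "Y = eval M v ` terms S"
  define g where "g y = (SOME t. t \<in> terms S \<and> eval M v t = y)" for y
  have g: "g y \<in> terms S" "eval M v (g y) = y" if "y \<in> Y" for y
  proof -
    have "\<exists>t. t \<in> terms S \<and> eval M v t = y" using that by (auto simp: Y_def)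
    from someI_ex[OF this] show "g y \<in> terms S" "eval M v (g y) = y" by (auto simp: g_def)
  qed
  define N where
    "N = \<lparr>carrier = g ` Y, interp = (\<lambda>f ts. g (interp M f (map (eval M v) ts)))\<rparr>"
  have cN: "carrier N = g ` Y" and iN: "\<And>f ts. interp N f ts = g (eval M v (Op f ts))"
    by (simp_all add: N_def)
  have sub: "carrier N \<subseteq> terms S" using g by (auto simp: cN)
  have opY: "eval M v (Op f ts) \<in> Y" if "S f = Some (length ts)" "set ts \<subseteq> carrier N" for f ts
    unfolding Y_def by (rule imageI, rule terms.Op) (use that sub in auto)
  have uN: "ualgebra S N"
    unfolding ualgebra_def
  proof (intro conjI allI impI)
    show "carrier N \<noteq> {}" by (auto simp: cN Y_def intro: terms.Var)
    fix f ts assume "S f = Some (length ts)" "set ts \<subseteq> carrier N"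
    thus "interp N f ts \<in> carrier N" using opY unfolding iN cN by blast
  qed
  have hN: "eval M v \<in> hom S N M"
    unfolding hom_def
  proof (intro CollectI conjI allI impI)
    show "eval M v \<in> carrier N \<rightarrow> carrier M"
      using sub eval_closed[OF uM _ v] by auto
    fix f ts assume "S f = Some (length ts)" "set ts \<subseteq> carrier N"
    thus "eval M v (interp N f ts) = interp M f (map (eval M v) ts)"
      using g(2)[OF opY] unfolding iN by simp
  qed
  have inj: "inj_on (eval M v) (carrier N)"
    using g by (auto simp: inj_on_def cN)
  have ran: "range v \<subseteq> eval M v ` carrier N"
  proof
    fix y assume "y \<in> range v"
    then obtain i where "y = eval M v (Var i)" by auto
    moreover have "Var i \<in> terms S" by (rule terms.Var)
    ultimately have "y \<in> Y" unfolding Y_def by (rule image_eqI)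
    thus "y \<in> eval M v ` carrier N" using g by (force simp: cN)
  qed
  have "eval N w s = eval N w t" if st: "(s, t) \<in> E" and w: "range w \<subseteq> carrier N" for s t w
  proof -
    have st': "s \<in> terms S" "t \<in> terms S" using st E by auto
    have "range (eval M v \<circ> w) \<subseteq> carrier M"
      using w sub eval_closed[OF uM _ v] by auto
    hence "eval M (eval M v \<circ> w) s = eval M (eval M v \<circ> w) t"
      using M st by (auto simp: models_def)
    hence "eval M v (eval N w s) = eval M v (eval N w t)"
      using eval_hom[OF uN hN _ w] st' by simp
    thus ?thesis
      using inj eval_closed[OF uN _ w] st' by (auto simp: inj_on_def)
  qed
  hence "N \<in> models S E" using uN by (auto simp: models_def)
  with hN ran inj show thesis using that by blast
qed

lemma pullback_Con:
  assumes N: "ualgebra S N" and h: "h \<in> hom S N M" and \<theta>: "\<theta> \<in> Con S M"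
  shows "pullback N h \<theta> \<in> Con S N"
proof (rule ConI)
  have hc: "h x \<in> carrier M" if "x \<in> carrier N" for x
    using h that by (auto simp: hom_def)
  have eq: "equiv (carrier M) \<theta>" by (rule Con_equiv[OF \<theta>])
  show "equiv (carrier N) (pullback N h \<theta>)"
  proof (rule equivI)
    show "refl_on (carrier N) (pullback N h \<theta>)"
      using eq hc by (auto simp: refl_on_def pullback_def equiv_def)
    show "sym (pullback N h \<theta>)" using eq by (auto simp: sym_def pullback_def equiv_def)
    show "trans (pullback N h \<theta>)"
      using eq unfolding trans_def pullback_def equiv_def by blast
  qed (auto simp: pullback_def)
  fix f xs ys
  assume S: "S f = Some (length xs)"
    and xy: "list_all2 (\<lambda>x y. (x, y) \<in> pullback N h \<theta>) xs ys"
  have len: "length xs = length ys" and X: "set xs \<subseteq> carrier N" "set ys \<subseteq> carrier N"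
    using xy by (auto simp: list_all2_conv_all_nth in_set_conv_nth pullback_def)
  have "list_all2 (\<lambda>x y. (x, y) \<in> \<theta>) (map h xs) (map h ys)"
    unfolding list_all2_map1 list_all2_map2
    using xy by (rule list_all2_mono) (auto simp: pullback_def)
  hence "(interp M f (map h xs), interp M f (map h ys)) \<in> \<theta>"
    using Con_compat[OF \<theta>] S by auto
  hence "(h (interp N f xs), h (interp N f ys)) \<in> \<theta>"
    using h S X len by (auto simp: hom_def)
  moreover have "interp N f xs \<in> carrier N" "interp N f ys \<in> carrier N"
    using N S X len by (auto simp: ualgebra_def)
  ultimately show "(interp N f xs, interp N f ys) \<in> pullback N h \<theta>"
    by (simp add: pullback_def)
qed

lemma rtrancl_enum:
  assumes "(x, y) \<in> R\<^sup>*" "R \<subseteq> X \<times> X" "x \<in> X"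
  obtains v :: "nat \<Rightarrow> 'a" and n where
    "range v \<subseteq> X" "v 0 = x" "v n = y" "\<forall>i<n. (v i, v (Suc i)) \<in> R"
proof -
  obtain n where "(x, y) \<in> R ^^ n" using assms(1) by (auto simp: rtrancl_power)
  then obtain u where u: "u 0 = x" "u n = y" "\<forall>i<n. (u i, u (Suc i)) \<in> R"
    by (auto simp: relpow_fun_conv)
  define v where "v i = u (min i n)" for i
  have "u i \<in> X" if "i \<le> n" for i
    using that u assms(2,3) by (cases i) (auto dest!: spec[of _ "i - 1"])
  hence "range v \<subseteq> X" by (auto simp: v_def)
  thus thesis using that[of v n] u by (auto simp: v_def min_def)
qed

text \<open>
  A pair in the join of two congruences of \<open>M\<close> lifts to a pair in the join of their pullbacks
  to some algebra of terms embedded in \<open>M\<close>.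
\<close>

lemma join_lift:
  fixes M :: "('f, 'a) ualg"
  assumes M: "M \<in> models S E" and E: "E \<subseteq> terms S \<times> terms S"
    and \<alpha>: "\<alpha> \<in> Con S M" and \<beta>: "\<beta> \<in> Con S M"
    and xy: "(x, y) \<in> \<alpha> \<squnion>\<^bsub>con_lattice S M\<^esub> \<beta>"
  obtains N :: "('f, ('f, nat) trm) ualg" and h x' y'
  where "N \<in> models S E" "h \<in> hom S N M" "x' \<in> carrier N" "y' \<in> carrier N" "h x' = x" "h y' = y"
    "(x', y') \<in> pullback N h \<alpha> \<squnion>\<^bsub>con_lattice S N\<^esub> pullback N h \<beta>"
proof -
  have uM: "ualgebra S M" using M by (simp add: models_def)
  interpret LM: lattice "con_lattice S M" by (rule lattice_Con[OF uM])
  have "\<alpha> \<squnion>\<^bsub>con_lattice S M\<^esub> \<beta> \<in> Con S M"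
    using LM.join_closed[of \<alpha> \<beta>] \<alpha> \<beta> by simp
  hence x: "x \<in> carrier M" using xy Con_sub by blast
  have "(x, y) \<in> (\<alpha> \<union> \<beta>)\<^sup>*" using join_Con_rtrancl[OF uM \<alpha> \<beta>] xy by blast
  moreover have "\<alpha> \<union> \<beta> \<subseteq> nabla M" using Con_sub[OF \<alpha>] Con_sub[OF \<beta>] by blast
  ultimately obtain v n where v: "range v \<subseteq> carrier M" "v 0 = x" "v n = y"
      "\<forall>i<n. (v i, v (Suc i)) \<in> \<alpha> \<union> \<beta>"
    using rtrancl_enum[OF _ _ x] by metis
  obtain N :: "('f, ('f, nat) trm) ualg" and h where N: "N \<in> models S E"
    and h: "h \<in> hom S N M" and ran: "range v \<subseteq> h ` carrier N" and inj: "inj_on h (carrier N)"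
    using term_subalgebra[OF M E v(1)] by blast
  have uN: "ualgebra S N" using N by (simp add: models_def)
  interpret LN: lattice "con_lattice S N" by (rule lattice_Con[OF uN])
  let ?A = "pullback N h \<alpha>" and ?B = "pullback N h \<beta>"
  let ?J = "?A \<squnion>\<^bsub>con_lattice S N\<^esub> ?B"
  have A: "?A \<in> Con S N" and B: "?B \<in> Con S N"
    using pullback_Con[OF uN h] \<alpha> \<beta> by auto
  have J: "?J \<in> Con S N" using LN.join_closed[of ?A ?B] A B by simp
  have AJ: "?A \<subseteq> ?J" "?B \<subseteq> ?J"
    using LN.join_left[of ?A ?B] LN.join_right[of ?A ?B] A B by auto
  have "\<forall>i. \<exists>u. u \<in> carrier N \<and> h u = v i" using ran by (metis imageE rangeI subsetD)
  then obtain u where u: "u i \<in> carrier N" "h (u i) = v i" for i by metis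
  have "(u 0, u i) \<in> ?J" if "i \<le> n" for i
    using that
  proof (induction i)
    case 0
    then show ?case using u Con_equiv[OF J] by (auto simp: equiv_def refl_on_def)
  next
    case (Suc i)
    have "(u i, u (Suc i)) \<in> ?A \<union> ?B"
      using v(4) Suc.prems u by (auto simp: pullback_def)
    hence "(u i, u (Suc i)) \<in> ?J" using AJ by blast
    then show ?case
      using Suc Con_equiv[OF J] unfolding equiv_def trans_def by (meson Suc_leD)
  qed
  thus thesis using that[OF N h, of "u 0" "u n"] u v by auto
qed

lemma pullback_join:
  assumes uM: "ualgebra S M" and uN: "ualgebra S N" and h: "h \<in> hom S N M"
    and \<alpha>: "\<alpha> \<in> Con S M" and \<beta>: "\<beta> \<in> Con S M"
  shows "pullback N h \<alpha> \<squnion>\<^bsub>con_lattice S N\<^esub> pullback N h \<beta>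
           \<subseteq> pullback N h (\<alpha> \<squnion>\<^bsub>con_lattice S M\<^esub> \<beta>)"
proof -
  interpret LM: lattice "con_lattice S M" by (rule lattice_Con[OF uM])
  interpret LN: lattice "con_lattice S N" by (rule lattice_Con[OF uN])
  let ?J = "\<alpha> \<squnion>\<^bsub>con_lattice S M\<^esub> \<beta>"
  have "?J \<in> Con S M" using LM.join_closed[of \<alpha> \<beta>] \<alpha> \<beta> by simp
  moreover have "\<alpha> \<subseteq> ?J" "\<beta> \<subseteq> ?J"
    using LM.join_left[of \<alpha> \<beta>] LM.join_right[of \<alpha> \<beta>] \<alpha> \<beta> by auto
  hence "pullback N h \<alpha> \<subseteq> pullback N h ?J" "pullback N h \<beta> \<subseteq> pullback N h ?J"
    by (auto simp: pullback_def)
  ultimately show ?thesis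
    using LN.join_le[of "pullback N h \<alpha>" "pullback N h ?J" "pullback N h \<beta>"]
      pullback_Con[OF uN h] \<alpha> \<beta> by simp
qed

lemma pullback_Int: "pullback N h (\<alpha> \<inter> \<beta>) = pullback N h \<alpha> \<inter> pullback N h \<beta>"
  by (auto simp: pullback_def)

lemma congruence_modularD:
  fixes M :: "('f, 'a) ualg"
  assumes cm: "congruence_modular S E" and E: "E \<subseteq> terms S \<times> terms S" and M: "M \<in> models S E"
  shows "modular_lattice (con_lattice S M)"
proof -
  have uM: "ualgebra S M" using M by (simp add: models_def)
  interpret LM: lattice "con_lattice S M" by (rule lattice_Con[OF uM])
  show ?thesis
  proof unfold_locales
    fix \<alpha> \<beta> \<gamma>
    assume "\<alpha> \<in> carrier (con_lattice S M)" "\<beta> \<in> carrier (con_lattice S M)"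
      "\<gamma> \<in> carrier (con_lattice S M)" "\<alpha> \<sqsubseteq>\<^bsub>con_lattice S M\<^esub> \<gamma>"
    hence \<alpha>: "\<alpha> \<in> Con S M" and \<beta>: "\<beta> \<in> Con S M" and \<gamma>: "\<gamma> \<in> Con S M" and le: "\<alpha> \<subseteq> \<gamma>"
      by simp_all
    let ?j = "join (con_lattice S M)"
    have bc: "\<beta> \<inter> \<gamma> \<in> Con S M" using Con_Int \<beta> \<gamma> .
    have ab: "?j \<alpha> \<beta> \<in> Con S M" using LM.join_closed[of \<alpha> \<beta>] \<alpha> \<beta> by simp
    have "?j \<alpha> (\<beta> \<inter> \<gamma>) \<subseteq> ?j \<alpha> \<beta>" "?j \<alpha> (\<beta> \<inter> \<gamma>) \<subseteq> \<gamma>"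
      using LM.join_le[of \<alpha> "?j \<alpha> \<beta>" "\<beta> \<inter> \<gamma>"] LM.join_le[of \<alpha> \<gamma> "\<beta> \<inter> \<gamma>"]
        LM.join_left[of \<alpha> \<beta>] LM.join_right[of \<alpha> \<beta>] \<alpha> \<beta> \<gamma> bc ab le by auto
    moreover have "?j \<alpha> \<beta> \<inter> \<gamma> \<subseteq> ?j \<alpha> (\<beta> \<inter> \<gamma>)"
    proof (rule subrelI)
      fix x y assume xy: "(x, y) \<in> ?j \<alpha> \<beta> \<inter> \<gamma>"
      obtain N :: "('f, ('f, nat) trm) ualg" and h x' y' where N: "N \<in> models S E"
        and h: "h \<in> hom S N M" and x': "x' \<in> carrier N" "y' \<in> carrier N" "h x' = x" "h y' = y"
        and j: "(x', y') \<in> pullback N h \<alpha> \<squnion>\<^bsub>con_lattice S N\<^esub> pullback N h \<beta>"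
        using join_lift[OF M E \<alpha> \<beta>, of x y] xy by blast
      have uN: "ualgebra S N" using N by (simp add: models_def)
      interpret LN: modular_lattice "con_lattice S N"
        using cm N by (simp add: congruence_modular_def)
      let ?a = "pullback N h \<alpha>" and ?b = "pullback N h \<beta>" and ?c = "pullback N h \<gamma>"
      let ?jN = "join (con_lattice S N)"
      have abc: "?a \<in> Con S N" "?b \<in> Con S N" "?c \<in> Con S N"
        using pullback_Con[OF uN h] \<alpha> \<beta> \<gamma> by auto
      have jab: "?jN ?a ?b \<in> Con S N" using LN.join_closed[of ?a ?b] abc by simp
      have "?a \<subseteq> ?c" using le by (auto simp: pullback_def)
      hence "?jN ?a (?b \<inter> ?c) = ?jN ?a ?b \<inter> ?c"
        using LN.modular[of ?a ?b ?c] abc meet_Con[OF uN] jab by simp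
      moreover have "(x', y') \<in> ?c" using xy x' by (auto simp: pullback_def)
      ultimately have "(x', y') \<in> ?jN ?a (pullback N h (\<beta> \<inter> \<gamma>))"
        using j by (simp add: pullback_Int)
      hence "(x', y') \<in> pullback N h (?j \<alpha> (\<beta> \<inter> \<gamma>))"
        using pullback_join[OF uM uN h \<alpha> bc] by blast
      thus "(x, y) \<in> ?j \<alpha> (\<beta> \<inter> \<gamma>)" using x' by (auto simp: pullback_def)
    qed
    ultimately have "?j \<alpha> (\<beta> \<inter> \<gamma>) = ?j \<alpha> \<beta> \<inter> \<gamma>" by blast
    thus "?j \<alpha> (\<beta> \<sqinter>\<^bsub>con_lattice S M\<^esub> \<gamma>) = ?j \<alpha> \<beta> \<sqinter>\<^bsub>con_lattice S M\<^esub> \<gamma>"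
      using meet_Con[OF uM] \<beta> \<gamma> ab by simp
  qed
qed

lemma congruence_distributiveD:
  fixes M :: "('f, 'a) ualg"
  assumes cd: "congruence_distributive S E" and E: "E \<subseteq> terms S \<times> terms S"
    and M: "M \<in> models S E"
  shows "distributive_lattice (con_lattice S M)"
proof -
  have uM: "ualgebra S M" using M by (simp add: models_def)
  interpret LM: lattice "con_lattice S M" by (rule lattice_Con[OF uM])
  show ?thesis
  proof unfold_locales
    fix \<alpha> \<beta> \<gamma>
    assume "\<alpha> \<in> carrier (con_lattice S M)" "\<beta> \<in> carrier (con_lattice S M)"
      "\<gamma> \<in> carrier (con_lattice S M)"
    hence \<alpha>: "\<alpha> \<in> Con S M" and \<beta>: "\<beta> \<in> Con S M" and \<gamma>: "\<gamma> \<in> Con S M" by simp_all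
    let ?j = "join (con_lattice S M)"
    have ab: "\<alpha> \<inter> \<beta> \<in> Con S M" and ac: "\<alpha> \<inter> \<gamma> \<in> Con S M"
      using Con_Int \<alpha> \<beta> \<gamma> by blast+
    have bc: "?j \<beta> \<gamma> \<in> Con S M" using LM.join_closed[of \<beta> \<gamma>] \<beta> \<gamma> by simp
    have "\<beta> \<subseteq> ?j \<beta> \<gamma>" "\<gamma> \<subseteq> ?j \<beta> \<gamma>"
      using LM.join_left[of \<beta> \<gamma>] LM.join_right[of \<beta> \<gamma>] \<beta> \<gamma> by auto
    hence "?j (\<alpha> \<inter> \<beta>) (\<alpha> \<inter> \<gamma>) \<subseteq> \<alpha> \<inter> ?j \<beta> \<gamma>"
      using LM.join_le[of "\<alpha> \<inter> \<beta>" "\<alpha> \<inter> ?j \<beta> \<gamma>" "\<alpha> \<inter> \<gamma>"] Con_Int[OF \<alpha> bc] ab ac by auto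
    moreover have "\<alpha> \<inter> ?j \<beta> \<gamma> \<subseteq> ?j (\<alpha> \<inter> \<beta>) (\<alpha> \<inter> \<gamma>)"
    proof (rule subrelI)
      fix x y assume xy: "(x, y) \<in> \<alpha> \<inter> ?j \<beta> \<gamma>"
      obtain N :: "('f, ('f, nat) trm) ualg" and h x' y' where N: "N \<in> models S E"
        and h: "h \<in> hom S N M" and x': "x' \<in> carrier N" "y' \<in> carrier N" "h x' = x" "h y' = y"
        and j: "(x', y') \<in> pullback N h \<beta> \<squnion>\<^bsub>con_lattice S N\<^esub> pullback N h \<gamma>"
        using join_lift[OF M E \<beta> \<gamma>, of x y] xy by blast
      have uN: "ualgebra S N" using N by (simp add: models_def)
      interpret LN: distributive_lattice "con_lattice S N"
        using cd N by (simp add: congruence_distributive_def)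
      let ?a = "pullback N h \<alpha>" and ?b = "pullback N h \<beta>" and ?c = "pullback N h \<gamma>"
      let ?jN = "join (con_lattice S N)"
      have abc: "?a \<in> Con S N" "?b \<in> Con S N" "?c \<in> Con S N"
        using pullback_Con[OF uN h] \<alpha> \<beta> \<gamma> by auto
      have jbc: "?jN ?b ?c \<in> Con S N" using LN.join_closed[of ?b ?c] abc by simp
      have "?a \<inter> ?jN ?b ?c = ?jN (?a \<inter> ?b) (?a \<inter> ?c)"
        using LN.distributive[of ?a ?b ?c] abc meet_Con[OF uN] jbc by simp
      moreover have "(x', y') \<in> ?a" using xy x' by (auto simp: pullback_def)
      ultimately have "(x', y') \<in> ?jN (pullback N h (\<alpha> \<inter> \<beta>)) (pullback N h (\<alpha> \<inter> \<gamma>))"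
        using j by (auto simp: pullback_Int)
      hence "(x', y') \<in> pullback N h (?j (\<alpha> \<inter> \<beta>) (\<alpha> \<inter> \<gamma>))"
        using pullback_join[OF uM uN h ab ac] by blast
      thus "(x, y) \<in> ?j (\<alpha> \<inter> \<beta>) (\<alpha> \<inter> \<gamma>)" using x' by (auto simp: pullback_def)
    qed
    ultimately have "\<alpha> \<inter> ?j \<beta> \<gamma> = ?j (\<alpha> \<inter> \<beta>) (\<alpha> \<inter> \<gamma>)" by blast
    thus "\<alpha> \<sqinter>\<^bsub>con_lattice S M\<^esub> ?j \<beta> \<gamma>
        = ?j (\<alpha> \<sqinter>\<^bsub>con_lattice S M\<^esub> \<beta>) (\<alpha> \<sqinter>\<^bsub>con_lattice S M\<^esub> \<gamma>)"
      using meet_Con[OF uM] \<alpha> \<beta> \<gamma> bc by simp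
  qed
qed

end

theory Submission
  imports Defs
begin

text \<open>
  In each of the three cases distinct prime congruences of \<open>A\<close> are incomparable, so Going Up holds
  trivially with \<open>\<psi>\<^sub>1 = \<phi>\<^sub>1\<close>. If \<open>Con(A)\<close> is Boolean and \<open>\<phi> \<subseteq> \<psi>\<close> are prime, let \<open>\<gamma>\<close> be a complement
  of \<open>\<psi>\<close>. The commutator of \<open>\<psi>\<close> and \<open>\<gamma>\<close> lies in their intersection, which is the least congruence, so
  \<open>\<psi> \<subseteq> \<phi>\<close> or \<open>\<gamma> \<subseteq> \<phi> \<subseteq> \<psi>\<close>; the latter would make \<open>\<psi>\<close> equal to \<open>\<psi> \<squnion> \<gamma> = \<nabla>\<close>.
\<close>

lemma eval_Con:
  assumes "\<theta> \<in> Con S M" "t \<in> terms S" "\<And>x. (v x, w x) \<in> \<theta>"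
  shows "(eval M v t, eval M w t) \<in> \<theta>"
  using assms(2)
proof (induction rule: terms.induct)
  case (Op f ts)
  have "list_all2 (\<lambda>x y. (x, y) \<in> \<theta>) (map (eval M v) ts) (map (eval M w) ts)"
    using Op by (auto simp: list_all2_conv_all_nth)
  then show ?case
    using Con_compat[OF assms(1), of f "map (eval M v) ts"] Op by simp
qed (use assms(3) in simp)

text \<open>Modulo \<open>\<beta>\<close>, the values at (b, c) and (b, d) are related because c and
  d are. Modulo \<open>\<alpha>\<close>, the value at (b, c) is linked to that at (a, c), by the
  premise to that at (a, d), and then to that at (b, d).\<close>

lemma term_condition_Int:
  assumes "ualgebra S M" and \<alpha>: "\<alpha> \<in> Con S M" and \<beta>: "\<beta> \<in> Con S M"
  shows "term_condition S M \<alpha> \<beta> (\<alpha> \<inter> \<beta>)"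
  unfolding term_condition_def
proof (intro ballI allI impI)
  fix t :: "(_, nat + nat) trm" and a b c d
  assume t: "t \<in> terms S" and ab: "\<forall>i. (a i, b i) \<in> \<alpha>" and cd: "\<forall>j. (c j, d j) \<in> \<beta>"
    and ac: "(eval M (case_sum a c) t, eval M (case_sum a d) t) \<in> \<alpha> \<inter> \<beta>"
  have refl: "(x, x) \<in> \<theta>" if "\<theta> \<in> Con S M" "x \<in> carrier M" for x \<theta>
    using that Con_equiv by (metis equiv_def refl_onD)
  have carr: "b i \<in> carrier M" "c i \<in> carrier M" "d i \<in> carrier M" for i
    using ab cd Con_sub[OF \<alpha>] Con_sub[OF \<beta>] by blast+
  \<comment> \<open>Both assignments agree on the \<open>Inl\<close> variables, where reflexivity
    suffices.\<close>
  have "(eval M (case_sum b c) t, eval M (case_sum b d) t) \<in> \<beta>"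
    using cd refl[OF \<beta> carr(1)] by (intro eval_Con[OF \<beta> t]) (auto split: sum.split)
  moreover have "(eval M (case_sum a c) t, eval M (case_sum b c) t) \<in> \<alpha>"
    using ab refl[OF \<alpha> carr(2)] by (intro eval_Con[OF \<alpha> t]) (auto split: sum.split)
  moreover have "(eval M (case_sum a d) t, eval M (case_sum b d) t) \<in> \<alpha>"
    using ab refl[OF \<alpha> carr(3)] by (intro eval_Con[OF \<alpha> t]) (auto split: sum.split)
  ultimately show "(eval M (case_sum b c) t, eval M (case_sum b d) t) \<in> \<alpha> \<inter> \<beta>"
    using ac Con_equiv[OF \<alpha>] unfolding equiv_def by (meson IntD1 IntI symD transD)
qed

text \<open>\<open>\<alpha> \<inter> \<beta>\<close> is itself one of the congruences whose
  intersection is the commutator.\<close>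

lemma commutator_subset_Int:
  assumes "ualgebra S M" "\<alpha> \<in> Con S M" "\<beta> \<in> Con S M"
  shows "commutator S M \<alpha> \<beta> \<subseteq> \<alpha> \<inter> \<beta>"
  using term_condition_Int[OF assms] Con_Int[OF assms(2,3)] by (auto simp: commutator_def)

lemma Spec_antichain_if_boolean:
  assumes M: "ualgebra S M" and "boolean_lattice (con_lattice S M)"
    and \<phi>: "\<phi> \<in> Spec S M" and \<psi>: "\<psi> \<in> Spec S M" and le: "\<phi> \<subseteq> \<psi>"
  shows "\<phi> = \<psi>"
proof -
  interpret boolean_lattice "con_lattice S M" by fact
  have \<phi>C: "\<phi> \<in> Con S M" and \<psi>C: "\<psi> \<in> Con S M" and proper: "\<psi> \<noteq> nabla M"
    using \<phi> \<psi> by (auto simp: Spec_def)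
  obtain \<gamma> where \<gamma>: "\<gamma> \<in> Con S M" and meet: "\<psi> \<inter> \<gamma> = \<bottom>\<^bsub>con_lattice S M\<^esub>"
    and join: "\<psi> \<squnion>\<^bsub>con_lattice S M\<^esub> \<gamma> = \<top>\<^bsub>con_lattice S M\<^esub>"
    using complemented[of \<psi>] \<psi>C meet_Con[OF M \<psi>C] by auto
  have "\<psi> \<inter> \<gamma> \<subseteq> \<phi>" using bottom_lower[of \<phi>] meet \<phi>C by simp
  hence "\<psi> \<subseteq> \<phi> \<or> \<gamma> \<subseteq> \<phi>"
    using \<phi> \<psi>C \<gamma> commutator_subset_Int[OF M \<psi>C \<gamma>] unfolding Spec_def by blast
  moreover have "\<not> \<gamma> \<subseteq> \<phi>"
  proof
    assume "\<gamma> \<subseteq> \<phi>"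
    hence "\<psi> \<squnion>\<^bsub>con_lattice S M\<^esub> \<gamma> \<subseteq> \<psi>"
      using join_le[of \<psi> \<psi> \<gamma>] \<psi>C \<gamma> le by simp
    \<comment> \<open>The top is known only as the greatest element of the lattice; that it contains
      \<open>nabla M\<close> already forces \<open>nabla M \<subseteq> \<psi>\<close>, against
      properness of \<open>\<psi>\<close>.\<close>
    moreover have "nabla M \<subseteq> \<top>\<^bsub>con_lattice S M\<^esub>"
      using top_higher[of "nabla M"] nabla_in_Con[OF M] by simp
    ultimately show False using join proper Con_sub[OF \<psi>C] by auto
  qed
  ultimately show ?thesis using le by blast
qed

lemma fulfills_GU_if_antichain:
  assumes "\<And>\<phi> \<psi>. \<lbrakk>\<phi> \<in> Spec S A; \<psi> \<in> Spec S A; \<phi> \<subseteq> \<psi>\<rbrakk> \<Longrightarrow> \<phi> = \<psi>"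
  shows "fulfills_GU S A B f"
  using assms unfolding fulfills_GU_def by blast

theorem lemma5p1:
  fixes S :: "'f signature" and E :: "'f equations"
    and A :: "('f, 'a) ualg" and B :: "('f, 'b) ualg" and f :: "'a \<Rightarrow> 'b"
  assumes "E \<subseteq> terms S \<times> terms S"
    and "congruence_modular S E"
    and "A \<in> models S E" and "B \<in> models S E"
    and "admissible S A B f"
  shows "(Spec S A = Max_con S A \<longrightarrow> fulfills_GU S A B f) \<and>
    ((\<forall>\<alpha>\<in>Con S A. \<forall>\<beta>\<in>Con S A. commutator S A \<alpha> \<beta> = \<alpha> \<inter> \<beta>) \<and>
       boolean_lattice (con_lattice S A) \<longrightarrow> fulfills_GU S A B f) \<and>
    (congruence_distributive S E \<and> boolean_lattice (con_lattice S A) \<longrightarrow> fulfills_GU S A B f)"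
proof -
  have "ualgebra S A" using assms(3) by (simp add: models_def)
  \<comment> \<open>This settles both claims that assume a Boolean \<open>Con S A\<close>.\<close>
  hence "fulfills_GU S A B f" if "boolean_lattice (con_lattice S A)"
    using that by (intro fulfills_GU_if_antichain Spec_antichain_if_boolean)
  \<comment> \<open>Each prime is now maximal, so a prime above it, being proper, equals it.\<close>
  moreover have "fulfills_GU S A B f" if "Spec S A = Max_con S A"
    using that by (intro fulfills_GU_if_antichain) (auto simp: Max_con_def)
  ultimately show ?thesis by blast
qed

end
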